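(* Let $R$ be any ring, not necessarily commutative. Then the set $$[R]_q = \{[x]_q : x \in R\}, \qquad [x]_q = \frac{1-q^x}{1-q},$$ is a ring with addition defined by $$[x]_q \oplus_q [y]_q = [x]_q + q^x [y]_q$$ and multiplication defined by $$[x]_q \otimes_q [y]_q = [x]_q\,[y]_{q^x},$$ and the map from $R$ to $[R]_q$ defined by $x \mapsto [x]_q$ is a ring isomorphism.
   Context: For a general ring $R$ all expressions are formal. For each $x\in R$, $q^x$ is a formal exponential, with distinct symbols for distinct $x$. These symbols obey $q^0=1$, $q^xq^y=q^{x+y}$ and $(q^x)^y=q^{xy}$, so that they form a multiplicatively written copy of the additive group of $R$ inside the integral group ring $\mathbf{Z}[R]$ of $(R,+)$. The expression $[x]_q=\frac{1-q^x}{1-q}$ is a formal fraction with numerator $1-q^x\in \mathbf{Z}[R]$ and fixed formal denominator $1-q$. Two formal fractions with this denominator are equal exactly when their numerators are equal in $\mathbf{Z}[R]$. The expression $[x]_q+q^x[y]_q$ means the formal fraction with numerator $(1-q^x)+q^x(1-q^y)$ and denominator $1-q$. The expression $[y]_{q^x}$ is obtained from $[y]_q$ by replacing $q$ with $q^x$, that is, it is the formal fraction $\frac{1-(q^x)^y}{1-q^x}$. In the product $[x]_q[y]_{q^x}=\frac{1-q^x}{1-q}\cdot\frac{1-(q^x)^y}{1-q^x}$ the formal common factor $1-q^x$ is cancelled, leaving the formal fraction with numerator $1-(q^x)^y$ and denominator $1-q$. *)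

theory Defs
  imports "HOL-Algebra.Free_Abelian_Groups" "HOL-Algebra.QuotRing"
begin

text \<open>The integral group ring of a (multiplicatively written) group \<open>G\<close>: the free abelian group on
  the elements of \<open>G\<close>, with the bilinear extension of the group law as multiplication.\<close>

definition group_ring :: "('a, 'm) monoid_scheme \<Rightarrow> ('a \<Rightarrow>\<^sub>0 int) ring"
  where "group_ring G =
    \<lparr>carrier = {c. Poly_Mapping.keys c \<subseteq> carrier G},
     monoid.mult = (\<lambda>a b. frag_extend (\<lambda>x. frag_extend (\<lambda>y. frag_of (x \<otimes>\<^bsub>G\<^esub> y)) b) a),
     one = frag_of \<one>\<^bsub>G\<^esub>,
     zero = 0,
     add = (+)\<rparr>"

text \<open>Formal fractions are not localized: equality is equality of numerators and of denominators,
  and a denominator may vanish (as \<open>1 - q\<close> does over the zero ring, and \<open>1 - q\<^sup>x\<close> for \<open>x = 0\<close>).\<close>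

datatype 'k formal_frac = Frac (numer: 'k) (denom: 'k)

definition frac_add ::
    "('k, 'm) ring_scheme \<Rightarrow> 'k formal_frac \<Rightarrow> 'k formal_frac \<Rightarrow> 'k formal_frac"
  where "frac_add A u v =
    (if denom u = denom v then Frac (numer u \<oplus>\<^bsub>A\<^esub> numer v) (denom u)
     else Frac (numer u \<otimes>\<^bsub>A\<^esub> denom v \<oplus>\<^bsub>A\<^esub> numer v \<otimes>\<^bsub>A\<^esub> denom u) (denom u \<otimes>\<^bsub>A\<^esub> denom v))"

definition frac_scale :: "('k, 'm) ring_scheme \<Rightarrow> 'k \<Rightarrow> 'k formal_frac \<Rightarrow> 'k formal_frac"
  where "frac_scale A c u = Frac (c \<otimes>\<^bsub>A\<^esub> numer u) (denom u)"

text \<open>\<open>(a / d) \<cdot> (b / a) = b / d\<close>: a common formal factor is cancelled, even when it is zero.\<close>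

definition frac_mult ::
    "('k, 'm) ring_scheme \<Rightarrow> 'k formal_frac \<Rightarrow> 'k formal_frac \<Rightarrow> 'k formal_frac"
  where "frac_mult A u v =
    (if numer u = denom v then Frac (numer v) (denom u)
     else Frac (numer u \<otimes>\<^bsub>A\<^esub> numer v) (denom u \<otimes>\<^bsub>A\<^esub> denom v))"

abbreviation exp_ring :: "('a, 'm) ring_scheme \<Rightarrow> ('a \<Rightarrow>\<^sub>0 int) ring"
  where "exp_ring R \<equiv> group_ring (add_monoid R)"

text \<open>\<open>q_exp x\<close> is the formal exponential \<open>q\<^sup>x\<close>.\<close>

abbreviation q_exp :: "'a \<Rightarrow> 'a \<Rightarrow>\<^sub>0 int"
  where "q_exp \<equiv> frag_of"

text \<open>\<open>b\<^sup>y\<close> for a formal exponential \<open>b\<close>, by the rule \<open>(q\<^sup>x)\<^sup>y = q\<^bsup>xy\<^esup>\<close>.\<close>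

definition exp_pow :: "('a, 'm) ring_scheme \<Rightarrow> ('a \<Rightarrow>\<^sub>0 int) \<Rightarrow> 'a \<Rightarrow> ('a \<Rightarrow>\<^sub>0 int)"
  where "exp_pow R b y = q_exp (inv_into (carrier R) q_exp b \<otimes>\<^bsub>R\<^esub> y)"

text \<open>\<open>q_int R x\<close> is \<open>[x]\<^sub>q\<close>, where the symbol \<open>q\<close> itself is \<open>q\<^sup>1\<close>; \<open>q_int_base R b y\<close> is \<open>[y]\<^sub>b\<close>, that is,
  \<open>[y]\<^sub>q\<close> with \<open>q\<close> replaced by \<open>b\<close>.\<close>

definition q_int :: "('a, 'm) ring_scheme \<Rightarrow> 'a \<Rightarrow> ('a \<Rightarrow>\<^sub>0 int) formal_frac"
  where "q_int R x =
    Frac (\<one>\<^bsub>exp_ring R\<^esub> \<ominus>\<^bsub>exp_ring R\<^esub> q_exp x)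
         (\<one>\<^bsub>exp_ring R\<^esub> \<ominus>\<^bsub>exp_ring R\<^esub> q_exp \<one>\<^bsub>R\<^esub>)"

definition q_int_base ::
    "('a, 'm) ring_scheme \<Rightarrow> ('a \<Rightarrow>\<^sub>0 int) \<Rightarrow> 'a \<Rightarrow> ('a \<Rightarrow>\<^sub>0 int) formal_frac"
  where "q_int_base R b y =
    Frac (\<one>\<^bsub>exp_ring R\<^esub> \<ominus>\<^bsub>exp_ring R\<^esub> exp_pow R b y)
         (\<one>\<^bsub>exp_ring R\<^esub> \<ominus>\<^bsub>exp_ring R\<^esub> b)"

definition q_ints :: "('a, 'm) ring_scheme \<Rightarrow> ('a \<Rightarrow>\<^sub>0 int) formal_frac set"
  where "q_ints R = {q_int R x | x. x \<in> carrier R}"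

text \<open>The operations on \<open>[R]\<^sub>q\<close> are described through representatives \<open>x, y\<close>; \<open>q_index\<close> chooses them.
  That the operations do not depend on the choice needs proof (injectivity of \<open>x \<mapsto> [x]\<^sub>q\<close>).\<close>

definition q_index :: "('a, 'm) ring_scheme \<Rightarrow> ('a \<Rightarrow>\<^sub>0 int) formal_frac \<Rightarrow> 'a"
  where "q_index R = inv_into (carrier R) (q_int R)"

definition q_ring :: "('a, 'm) ring_scheme \<Rightarrow> ('a \<Rightarrow>\<^sub>0 int) formal_frac ring"
  where "q_ring R =
    \<lparr>carrier = q_ints R,
     monoid.mult = (\<lambda>u v. frac_mult (exp_ring R) u (q_int_base R (q_exp (q_index R u)) (q_index R v))),
     one = q_int R \<one>\<^bsub>R\<^esub>,
     zero = q_int R \<zero>\<^bsub>R\<^esub>,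
     add = (\<lambda>u v. frac_add (exp_ring R) u (frac_scale (exp_ring R) (q_exp (q_index R u)) v))\<rparr>"

end

theory Submission
  imports Defs
begin

text \<open>The symbols \<open>q\<^sup>x\<close> are distinct basis elements of the group ring, and all the fractions \<open>[x]\<^sub>q\<close> share
  the denominator \<open>1 - q\<close>, so \<open>[x]\<^sub>q\<close> determines \<open>x\<close>: the map \<open>x \<mapsto> [x]\<^sub>q\<close> is a bijection from
  \<open>R\<close> onto \<open>[R]\<^sub>q\<close> (lemma \<open>q_int_inj_on\<close>). The two operations on fractions are well defined for this
  reason, and they telescope: \<open>(1 - q\<^sup>x) + q\<^sup>x (1 - q\<^sup>y) = 1 - q\<^bsup>x+y\<^esup>\<close>, so the sum of \<open>[x]\<^sub>q\<close> and
  \<open>[y]\<^sub>q\<close> is \<open>[x + y]\<^sub>q\<close> (lemma \<open>q_int_add\<close>), while cancelling \<open>1 - q\<^sup>x\<close> turns their product into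
  \<open>[xy]\<^sub>q\<close> (lemma \<open>q_int_mult\<close>). Hence the operations on \<open>[R]\<^sub>q\<close> are the operations of \<open>R\<close>
  transported along a bijection. The image of a ring under such a map is a ring, and the map
  is then an isomorphism.\<close>

text \<open>Subtraction in a structure whose carrier need not be the whole type is taken from the
  uniquely determined additive inverse; on the group ring it agrees with the subtraction of
  finitely supported functions, which is the one that can be computed with.\<close>

lemma group_ring_minus:
  assumes "a \<in> carrier (group_ring G)" "b \<in> carrier (group_ring G)"
  shows "a \<ominus>\<^bsub>group_ring G\<^esub> b = a - b"
proof -
  have "\<ominus>\<^bsub>group_ring G\<^esub> b = - b"
    unfolding a_inv_def m_inv_def
  proof (rule the_equality)
    show "- b \<in> carrier (add_monoid (group_ring G)) \<and>
        b \<otimes>\<^bsub>add_monoid (group_ring G)\<^esub> - b = \<one>\<^bsub>add_monoid (group_ring G)\<^esub> \<and>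
        - b \<otimes>\<^bsub>add_monoid (group_ring G)\<^esub> b = \<one>\<^bsub>add_monoid (group_ring G)\<^esub>"
      using assms(2) by (simp add: group_ring_def)
  next
    fix c
    assume "c \<in> carrier (add_monoid (group_ring G)) \<and>
        b \<otimes>\<^bsub>add_monoid (group_ring G)\<^esub> c = \<one>\<^bsub>add_monoid (group_ring G)\<^esub> \<and>
        c \<otimes>\<^bsub>add_monoid (group_ring G)\<^esub> b = \<one>\<^bsub>add_monoid (group_ring G)\<^esub>"
    then have "b + c = 0"
      by (simp add: group_ring_def)
    then show "c = - b"
      by (rule minus_unique[symmetric])
  qed
  then show ?thesis
    by (simp add: a_minus_def) (simp add: group_ring_def)
qed

lemma q_exp_eq_iff: "q_exp x = q_exp y \<longleftrightarrow> x = y"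
  by (metis keys_frag_of singleton_inject)

context ring
begin

lemma q_int_base_eq:
  assumes "z \<in> carrier R" "exp_pow R b y = q_exp z" "b \<in> carrier (exp_ring R)"
  shows "q_int_base R b y = Frac (q_exp \<zero> - q_exp z) (q_exp \<zero> - b)"
proof -
  have "\<one>\<^bsub>exp_ring R\<^esub> = q_exp \<zero>" "q_exp \<zero> \<in> carrier (exp_ring R)" "q_exp z \<in> carrier (exp_ring R)"
    using assms(1) by (auto simp: group_ring_def)
  then show ?thesis
    by (simp add: q_int_base_def assms group_ring_minus)
qed

lemma q_int_eq:
  assumes "x \<in> carrier R"
  shows "q_int R x = Frac (q_exp \<zero> - q_exp x) (q_exp \<zero> - q_exp \<one>)"
proof -
  have "\<one>\<^bsub>exp_ring R\<^esub> = q_exp \<zero>" "q_exp \<zero> \<in> carrier (exp_ring R)"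
    "q_exp x \<in> carrier (exp_ring R)" "q_exp \<one> \<in> carrier (exp_ring R)"
    using assms by (auto simp: group_ring_def)
  then show ?thesis
    by (simp add: q_int_def group_ring_minus)
qed

lemma q_int_inj_on: "inj_on (q_int R) (carrier R)"
  by (auto simp: inj_on_def q_int_eq q_exp_eq_iff)

lemma q_index_q_int: "x \<in> carrier R \<Longrightarrow> q_index R (q_int R x) = x"
  by (simp add: q_index_def q_int_inj_on)

lemma exp_pow_q_exp:
  assumes "x \<in> carrier R"
  shows "exp_pow R (q_exp x) y = q_exp (x \<otimes> y)"
proof -
  have "inj_on q_exp (carrier R)"
    by (simp add: inj_on_def q_exp_eq_iff)
  then have "inv_into (carrier R) q_exp (q_exp x) = x"
    using assms by (rule inv_into_f_f)
  then show ?thesis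
    unfolding exp_pow_def by (rule arg_cong)
qed

text \<open>Scaling by \<open>q\<^sup>x\<close> leaves the denominator \<open>1 - q\<close> alone, so only numerators are added, and
  there the terms \<open>- q\<^sup>x\<close> and \<open>q\<^sup>x \<cdot> q\<^sup>0\<close> cancel.\<close>

lemma q_int_add:
  assumes "x \<in> carrier R" "y \<in> carrier R"
  shows "frac_add (exp_ring R) (q_int R x) (frac_scale (exp_ring R) (q_exp x) (q_int R y))
    = q_int R (x \<oplus> y)"
  using assms
  by (simp add: q_int_eq frac_add_def frac_scale_def) (simp add: group_ring_def frag_extend_diff)

text \<open>The numerator of \<open>[x]\<^sub>q\<close> is literally the denominator of \<open>[y]\<close> in base \<open>q\<^sup>x\<close>, so the formal
  cancellation applies even where \<open>1 - q\<^sup>x\<close> vanishes.\<close>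

lemma q_int_mult:
  assumes "x \<in> carrier R" "y \<in> carrier R"
  shows "frac_mult (exp_ring R) (q_int R x) (q_int_base R (q_exp x) y) = q_int R (x \<otimes> y)"
proof -
  have "q_exp x \<in> carrier (exp_ring R)"
    using assms by (simp add: group_ring_def)
  then have "q_int_base R (q_exp x) y = Frac (q_exp \<zero> - q_exp (x \<otimes> y)) (q_exp \<zero> - q_exp x)"
    using assms by (intro q_int_base_eq) (simp_all add: exp_pow_q_exp)
  then show ?thesis
    using assms by (simp add: q_int_eq frac_mult_def)
qed

text \<open>The representatives chosen inside \<open>q_ring\<close> are the given ones, by injectivity; this is the
  well-definedness of the two operations.\<close>

lemma q_ring_add:
  assumes "x \<in> carrier R" "y \<in> carrier R"
  shows "q_int R x \<oplus>\<^bsub>q_ring R\<^esub> q_int R y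
    = frac_add (exp_ring R) (q_int R x) (frac_scale (exp_ring R) (q_exp x) (q_int R y))"
  using assms by (simp add: q_ring_def q_index_q_int)

lemma q_ring_mult:
  assumes "x \<in> carrier R" "y \<in> carrier R"
  shows "q_int R x \<otimes>\<^bsub>q_ring R\<^esub> q_int R y
    = frac_mult (exp_ring R) (q_int R x) (q_int_base R (q_exp x) y)"
  using assms by (simp add: q_ring_def q_index_q_int)

lemma q_int_ring_iso: "q_int R \<in> ring_iso R (q_ring R)"
proof (rule ring_iso_memI)
  show "bij_betw (q_int R) (carrier R) (carrier (q_ring R))"
    using q_int_inj_on by (auto simp: bij_betw_def q_ring_def q_ints_def)
qed (auto simp: q_ring_add q_int_add q_ring_mult q_int_mult, auto simp: q_ring_def q_ints_def)

lemma ring_q_ring: "ring (q_ring R)"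
proof -
  \<comment> \<open>A ring homomorphism need not mention zero, so transport of structure makes the image of zero
     the zero of the target; here that is already the case.\<close>
  have "(q_ring R)\<lparr>zero := q_int R \<zero>\<rparr> = q_ring R"
    by (simp add: q_ring_def)
  then show ?thesis
    using ring_iso_imp_img_ring[OF q_int_ring_iso] by simp
qed

end

theorem theorem1:
  fixes R :: "('a, 'm) ring_scheme"
  assumes "ring R"
  shows "(\<forall>x \<in> carrier R. \<forall>y \<in> carrier R.
            q_int R x \<oplus>\<^bsub>q_ring R\<^esub> q_int R y
              = frac_add (exp_ring R) (q_int R x) (frac_scale (exp_ring R) (q_exp x) (q_int R y)) \<and>
            q_int R x \<otimes>\<^bsub>q_ring R\<^esub> q_int R y
              = frac_mult (exp_ring R) (q_int R x) (q_int_base R (q_exp x) y))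
       \<and> ring (q_ring R)
       \<and> q_int R \<in> ring_iso R (q_ring R)"
proof -
  interpret ring R by fact
  show ?thesis
    using q_ring_add q_ring_mult ring_q_ring q_int_ring_iso by blast
qed

end
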